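(* Let $N$ be a set of positive integers. The class of $\ell$-bimonoidal subreducts of commutative involutive residuated lattices satisfying $x\leq x^{n}$ for all $n\in N$ is the variety of commutative $\ell$-bimonoids axiomatized by the inequalities $x\leq x^{n}$ and $nx\leq x$ for $n\in N$.
   Context: A commutative $\ell$-bimonoid $\langle A,\vee,\wedge,\cdot,1,+,0\rangle$ is a lattice with two commutative monoid operations $\cdot$ (unit $1$) and $+$ (unit $0$) such that $x\cdot(y\vee z)=(x\cdot y)\vee(x\cdot z)$, $x+(y\wedge z)=(x+y)\wedge(x+z)$ and $x\cdot(y+z)\leq(x\cdot y)+z$. Here $x^{n}$ is the $n$-fold product $x\cdot\ldots\cdot x$ and $nx$ the $n$-fold sum $x+\ldots+x$. A commutative involutive residuated lattice $\langle B,\vee,\wedge,\cdot,1,\rightarrow,0\rangle$ is a lattice with a commutative monoid operation $\cdot$, an operation $\rightarrow$ with $x\cdot y\leq z\iff y\leq x\rightarrow z$, and a constant $0$ with $(x\rightarrow 0)\rightarrow 0=x$; setting $\overline{x}=x\rightarrow 0$ and $x+y:=\overline{\overline{x}\cdot\overline{y}}$, its $\ell$-bimonoid reduct is $\langle B,\vee,\wedge,\cdot,1,+,0\rangle$. An $\ell$-bimonoidal subreduct of $\mathbf{B}$ is an $\ell$-bimonoid isomorphic to a subalgebra of this reduct. *)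

theory Defs
  imports "HOL-Algebra.Ring"
begin

locale lattice_algebra =
  fixes L :: "'a set" and join :: "'a \<Rightarrow> 'a \<Rightarrow> 'a" and meet :: "'a \<Rightarrow> 'a \<Rightarrow> 'a"
  assumes join_closed: "\<lbrakk>x \<in> L; y \<in> L\<rbrakk> \<Longrightarrow> join x y \<in> L"
    and meet_closed: "\<lbrakk>x \<in> L; y \<in> L\<rbrakk> \<Longrightarrow> meet x y \<in> L"
    and join_comm: "\<lbrakk>x \<in> L; y \<in> L\<rbrakk> \<Longrightarrow> join x y = join y x"
    and meet_comm: "\<lbrakk>x \<in> L; y \<in> L\<rbrakk> \<Longrightarrow> meet x y = meet y x"
    and join_assoc: "\<lbrakk>x \<in> L; y \<in> L; z \<in> L\<rbrakk> \<Longrightarrow> join (join x y) z = join x (join y z)"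
    and meet_assoc: "\<lbrakk>x \<in> L; y \<in> L; z \<in> L\<rbrakk> \<Longrightarrow> meet (meet x y) z = meet x (meet y z)"
    and join_absorb: "\<lbrakk>x \<in> L; y \<in> L\<rbrakk> \<Longrightarrow> join x (meet x y) = x"
    and meet_absorb: "\<lbrakk>x \<in> L; y \<in> L\<rbrakk> \<Longrightarrow> meet x (join x y) = x"


subsection \<open>Commutative l-bimonoids\<close>

text \<open>
  The record \<open>ring\<close> provides \<open>carrier\<close>, \<open>\<otimes>\<close>, \<open>\<one>\<close>, \<open>\<oplus>\<close>, \<open>\<zero>\<close> and nothing else (no axioms), so
  \<open>x [^] n\<close> is the \<open>n\<close>-fold product and \<open>[n] \<cdot> x\<close> the \<open>n\<close>-fold sum. The locale \<open>abelian_monoid\<close>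
  states that \<open>\<oplus>\<close>, \<open>\<zero>\<close> form a commutative monoid.
\<close>

record 'a l_bimonoid = "'a ring" +
  lb_join :: "'a \<Rightarrow> 'a \<Rightarrow> 'a" (infixl \<open>\<^bold>\<or>\<index>\<close> 65)
  lb_meet :: "'a \<Rightarrow> 'a \<Rightarrow> 'a" (infixl \<open>\<^bold>\<and>\<index>\<close> 65)

definition lb_le :: "('a, 'm) l_bimonoid_scheme \<Rightarrow> 'a \<Rightarrow> 'a \<Rightarrow> bool" (infix \<open>\<preceq>\<index>\<close> 50)
  where "x \<preceq>\<^bsub>A\<^esub> y \<longleftrightarrow> x \<^bold>\<and>\<^bsub>A\<^esub> y = x"

locale commutative_l_bimonoid =
  comm_monoid A + abelian_monoid A + lattice_algebra "carrier A" "lb_join A" "lb_meet A"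
  for A :: "('a, 'm) l_bimonoid_scheme" (structure) +
  assumes mult_join: "\<lbrakk>x \<in> carrier A; y \<in> carrier A; z \<in> carrier A\<rbrakk>
      \<Longrightarrow> x \<otimes> (y \<^bold>\<or> z) = (x \<otimes> y) \<^bold>\<or> (x \<otimes> z)"
    and add_meet: "\<lbrakk>x \<in> carrier A; y \<in> carrier A; z \<in> carrier A\<rbrakk>
      \<Longrightarrow> x \<oplus> (y \<^bold>\<and> z) = (x \<oplus> y) \<^bold>\<and> (x \<oplus> z)"
    and hemidistributive: "\<lbrakk>x \<in> carrier A; y \<in> carrier A; z \<in> carrier A\<rbrakk>
      \<Longrightarrow> x \<otimes> (y \<oplus> z) \<preceq> (x \<otimes> y) \<oplus> z"

definition lb_subalgebra :: "'a set \<Rightarrow> ('a, 'm) l_bimonoid_scheme \<Rightarrow> bool"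
  where "lb_subalgebra S A \<longleftrightarrow>
    S \<subseteq> carrier A \<and> \<one>\<^bsub>A\<^esub> \<in> S \<and> \<zero>\<^bsub>A\<^esub> \<in> S \<and>
    (\<forall>x\<in>S. \<forall>y\<in>S. x \<otimes>\<^bsub>A\<^esub> y \<in> S \<and> x \<oplus>\<^bsub>A\<^esub> y \<in> S \<and> x \<^bold>\<or>\<^bsub>A\<^esub> y \<in> S \<and> x \<^bold>\<and>\<^bsub>A\<^esub> y \<in> S)"

definition lb_iso ::
  "('a, 'm) l_bimonoid_scheme \<Rightarrow> ('b, 'n) l_bimonoid_scheme \<Rightarrow> ('a \<Rightarrow> 'b) set"
  where "lb_iso A C = {h. bij_betw h (carrier A) (carrier C) \<and>
    h \<one>\<^bsub>A\<^esub> = \<one>\<^bsub>C\<^esub> \<and> h \<zero>\<^bsub>A\<^esub> = \<zero>\<^bsub>C\<^esub> \<and>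
    (\<forall>x\<in>carrier A. \<forall>y\<in>carrier A.
      h (x \<otimes>\<^bsub>A\<^esub> y) = h x \<otimes>\<^bsub>C\<^esub> h y \<and> h (x \<oplus>\<^bsub>A\<^esub> y) = h x \<oplus>\<^bsub>C\<^esub> h y \<and>
      h (x \<^bold>\<or>\<^bsub>A\<^esub> y) = h x \<^bold>\<or>\<^bsub>C\<^esub> h y \<and> h (x \<^bold>\<and>\<^bsub>A\<^esub> y) = h x \<^bold>\<and>\<^bsub>C\<^esub> h y)}"


subsection \<open>Commutative involutive residuated lattices\<close>

record 'a cirl = "'a monoid" +
  rl_join :: "'a \<Rightarrow> 'a \<Rightarrow> 'a"
  rl_meet :: "'a \<Rightarrow> 'a \<Rightarrow> 'a"
  rl_imp :: "'a \<Rightarrow> 'a \<Rightarrow> 'a" (infixr \<open>\<rightarrow>\<index>\<close> 60)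
  rl_zero :: 'a

definition rl_le :: "('a, 'm) cirl_scheme \<Rightarrow> 'a \<Rightarrow> 'a \<Rightarrow> bool" (infix \<open>\<lesssim>\<index>\<close> 50)
  where "x \<lesssim>\<^bsub>B\<^esub> y \<longleftrightarrow> rl_meet B x y = x"

definition rl_neg :: "('a, 'm) cirl_scheme \<Rightarrow> 'a \<Rightarrow> 'a"
  where "rl_neg B x = x \<rightarrow>\<^bsub>B\<^esub> rl_zero B"

locale commutative_involutive_residuated_lattice =
  comm_monoid B + lattice_algebra "carrier B" "rl_join B" "rl_meet B"
  for B :: "('a, 'm) cirl_scheme" (structure) +
  assumes imp_closed: "\<lbrakk>x \<in> carrier B; y \<in> carrier B\<rbrakk> \<Longrightarrow> x \<rightarrow> y \<in> carrier B"
    and rl_zero_closed: "rl_zero B \<in> carrier B"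
    and residuation: "\<lbrakk>x \<in> carrier B; y \<in> carrier B; z \<in> carrier B\<rbrakk>
      \<Longrightarrow> x \<otimes> y \<lesssim> z \<longleftrightarrow> y \<lesssim> x \<rightarrow> z"
    and involutive: "x \<in> carrier B \<Longrightarrow> (x \<rightarrow> rl_zero B) \<rightarrow> rl_zero B = x"

definition l_bimonoid_reduct :: "('a, 'm) cirl_scheme \<Rightarrow> 'a l_bimonoid"
  where "l_bimonoid_reduct B =
    \<lparr>carrier = carrier B, mult = mult B, one = one B,
     zero = rl_zero B, add = (\<lambda>x y. rl_neg B (rl_neg B x \<otimes>\<^bsub>B\<^esub> rl_neg B y)),
     lb_join = rl_join B, lb_meet = rl_meet B\<rparr>"

text \<open>
  The reduct of a commutative involutive residuated lattice and all its subalgebras are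
  commutative l-bimonoids.
\<close>

context commutative_involutive_residuated_lattice
begin

lemma le_refl: "x \<in> carrier B \<Longrightarrow> x \<lesssim> x"
  unfolding rl_le_def by (metis join_absorb meet_absorb meet_closed)

lemma le_antisym: "\<lbrakk>x \<lesssim> y; y \<lesssim> x; x \<in> carrier B; y \<in> carrier B\<rbrakk> \<Longrightarrow> x = y"
  unfolding rl_le_def by (metis meet_comm)

lemma le_trans:
  "\<lbrakk>x \<lesssim> y; y \<lesssim> z; x \<in> carrier B; y \<in> carrier B; z \<in> carrier B\<rbrakk> \<Longrightarrow> x \<lesssim> z"
  unfolding rl_le_def by (metis meet_assoc)

lemma le_iff_join: "\<lbrakk>x \<in> carrier B; y \<in> carrier B\<rbrakk> \<Longrightarrow> x \<lesssim> y \<longleftrightarrow> rl_join B x y = y"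
  unfolding rl_le_def by (metis join_absorb meet_absorb join_comm meet_comm)

lemma le_meet_iff: "\<lbrakk>x \<in> carrier B; y \<in> carrier B; z \<in> carrier B\<rbrakk>
    \<Longrightarrow> x \<lesssim> rl_meet B y z \<longleftrightarrow> x \<lesssim> y \<and> x \<lesssim> z"
  unfolding rl_le_def by (smt (verit) meet_assoc meet_comm meet_closed le_refl rl_le_def)

lemma join_le_iff: "\<lbrakk>x \<in> carrier B; y \<in> carrier B; z \<in> carrier B\<rbrakk>
    \<Longrightarrow> rl_join B x y \<lesssim> z \<longleftrightarrow> x \<lesssim> z \<and> y \<lesssim> z"
  by (smt (verit) join_assoc join_comm join_closed le_iff_join le_refl)

lemma eqI_upper: "\<lbrakk>x \<in> carrier B; y \<in> carrier B; \<And>z. z \<in> carrier B \<Longrightarrow> x \<lesssim> z \<longleftrightarrow> y \<lesssim> z\<rbrakk> \<Longrightarrow> x = y"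
  using le_antisym le_refl by blast

lemma eqI_lower: "\<lbrakk>x \<in> carrier B; y \<in> carrier B; \<And>z. z \<in> carrier B \<Longrightarrow> z \<lesssim> x \<longleftrightarrow> z \<lesssim> y\<rbrakk> \<Longrightarrow> x = y"
  using le_antisym le_refl by blast

lemma neg_closed [simp]: "x \<in> carrier B \<Longrightarrow> rl_neg B x \<in> carrier B"
  unfolding rl_neg_def by (simp add: imp_closed rl_zero_closed)

lemma neg_neg [simp]: "x \<in> carrier B \<Longrightarrow> rl_neg B (rl_neg B x) = x"
  unfolding rl_neg_def by (simp add: involutive)

lemma le_neg_iff: "\<lbrakk>x \<in> carrier B; y \<in> carrier B\<rbrakk> \<Longrightarrow> y \<lesssim> rl_neg B x \<longleftrightarrow> x \<otimes> y \<lesssim> rl_zero B"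
  unfolding rl_neg_def by (simp add: residuation rl_zero_closed)

lemma le_neg_swap: "\<lbrakk>x \<in> carrier B; y \<in> carrier B\<rbrakk> \<Longrightarrow> y \<lesssim> rl_neg B x \<longleftrightarrow> x \<lesssim> rl_neg B y"
  by (simp add: le_neg_iff m_comm)

lemma neg_le_neg: "\<lbrakk>x \<in> carrier B; y \<in> carrier B\<rbrakk> \<Longrightarrow> rl_neg B y \<lesssim> rl_neg B x \<longleftrightarrow> x \<lesssim> y"
  using le_neg_swap[of x "rl_neg B y"] by simp

lemma neg_zero: "rl_neg B (rl_zero B) = \<one>"
proof -
  have "rl_neg B \<one> = rl_zero B"
    by (rule eqI_lower) (auto simp: le_neg_iff rl_zero_closed)
  then show ?thesis using neg_neg by fastforce
qed

lemma mult_rl_join: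
  assumes "x \<in> carrier B" "y \<in> carrier B" "z \<in> carrier B"
  shows "x \<otimes> rl_join B y z = rl_join B (x \<otimes> y) (x \<otimes> z)"
  by (rule eqI_upper)
    (use assms in \<open>auto simp: join_closed join_le_iff residuation imp_closed\<close>)

lemma neg_meet:
  assumes "x \<in> carrier B" "y \<in> carrier B"
  shows "rl_neg B (rl_meet B x y) = rl_join B (rl_neg B x) (rl_neg B y)"
proof -
  have "rl_meet B x y = rl_neg B (rl_join B (rl_neg B x) (rl_neg B y))"
    by (rule eqI_lower)
      (use assms in \<open>simp_all add: meet_closed join_closed le_meet_iff join_le_iff
        le_neg_swap[where x = "rl_join B _ _"] neg_le_neg\<close>)
  then show ?thesis using assms by (simp add: join_closed)
qed

lemma neg_join:
  assumes "x \<in> carrier B" "y \<in> carrier B"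
  shows "rl_neg B (rl_join B x y) = rl_meet B (rl_neg B x) (rl_neg B y)"
  using neg_meet[of "rl_neg B x" "rl_neg B y"] assms
  by (metis neg_neg neg_closed meet_closed)

lemma mult_mono: "\<lbrakk>y \<lesssim> z; x \<in> carrier B; y \<in> carrier B; z \<in> carrier B\<rbrakk> \<Longrightarrow> x \<otimes> y \<lesssim> x \<otimes> z"
  by (metis le_iff_join mult_rl_join m_closed)

lemma reduct_hemidistributive:
  assumes "x \<in> carrier B" "y \<in> carrier B" "z \<in> carrier B"
  shows "x \<otimes> rl_neg B (rl_neg B y \<otimes> rl_neg B z)
      \<lesssim> rl_neg B (rl_neg B (x \<otimes> y) \<otimes> rl_neg B z)"
proof -
  let ?n = "rl_neg B"
  let ?s = "?n (?n y \<otimes> ?n z)"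
  have c: "?n (x \<otimes> y) \<in> carrier B" "?n y \<in> carrier B" "?n z \<in> carrier B" "?s \<in> carrier B"
    using assms by auto
  have "x \<otimes> ?n (x \<otimes> y) \<lesssim> ?n y"
    using assms c le_refl[of "?n (x \<otimes> y)"] le_neg_iff[of "x \<otimes> y" "?n (x \<otimes> y)"]
    by (simp add: le_neg_iff m_ac)
  then have "(?s \<otimes> ?n z) \<otimes> (x \<otimes> ?n (x \<otimes> y)) \<lesssim> (?s \<otimes> ?n z) \<otimes> ?n y"
    using assms c by (intro mult_mono) auto
  moreover have "(?s \<otimes> ?n z) \<otimes> ?n y \<lesssim> rl_zero B"
    using c le_refl[of ?s] le_neg_iff[of "?n y \<otimes> ?n z" ?s] by (simp add: m_ac)
  ultimately have "(?s \<otimes> ?n z) \<otimes> (x \<otimes> ?n (x \<otimes> y)) \<lesssim> rl_zero B"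
    using assms c rl_zero_closed by (meson le_trans m_closed)
  then show ?thesis using assms c by (simp add: le_neg_iff m_ac)
qed

theorem reduct_commutative_l_bimonoid: "commutative_l_bimonoid (l_bimonoid_reduct B)"
proof -
  let ?R = "l_bimonoid_reduct B"
  have "comm_monoid ?R"
    by unfold_locales (auto simp: l_bimonoid_reduct_def m_ac)
  moreover have "abelian_monoid ?R"
    by unfold_locales
      (auto simp: l_bimonoid_reduct_def m_ac neg_zero rl_zero_closed)
  moreover have "lattice_algebra (carrier ?R) (lb_join ?R) (lb_meet ?R)"
    using lattice_algebra_axioms by (simp add: l_bimonoid_reduct_def)
  moreover have "commutative_l_bimonoid_axioms ?R"
    by unfold_locales
      (use reduct_hemidistributive in \<open>auto simp: l_bimonoid_reduct_def lb_le_def rl_le_def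
        mult_rl_join neg_meet neg_join\<close>)
  ultimately show ?thesis by (simp add: commutative_l_bimonoid_def)
qed

end

theorem subalgebra_commutative_l_bimonoid:
  assumes "commutative_l_bimonoid A" "lb_subalgebra S A"
  shows "commutative_l_bimonoid (A\<lparr>carrier := S\<rparr>)"
proof -
  interpret commutative_l_bimonoid A by fact
  have S: "\<And>x. x \<in> S \<Longrightarrow> x \<in> carrier A" using assms(2) by (auto simp: lb_subalgebra_def)
  show ?thesis
    by unfold_locales
      (use assms(2) S hemidistributive in \<open>auto simp: lb_subalgebra_def m_assoc a_assoc
        join_assoc meet_assoc join_absorb meet_absorb mult_join add_meet lb_le_def
        intro: m_comm a_comm join_comm meet_comm\<close>)
qed


subsection \<open>The two classes\<close>

definition l_bimonoidal_subreduct :: "'a l_bimonoid \<Rightarrow> 'b cirl \<Rightarrow> bool"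
  where "l_bimonoidal_subreduct A B \<longleftrightarrow> commutative_l_bimonoid A \<and>
    (\<exists>S. lb_subalgebra S (l_bimonoid_reduct B) \<and>
      lb_iso A ((l_bimonoid_reduct B)\<lparr>carrier := S\<rparr>) \<noteq> {})"

text \<open>
  A formula cannot quantify over types, so the type \<open>'b\<close> containing the carriers of the residuated
  lattices is a parameter of the class of subreducts.
\<close>

definition l_bimonoidal_subreducts :: "'b itself \<Rightarrow> nat set \<Rightarrow> 'a l_bimonoid set"
  where "l_bimonoidal_subreducts _ N = {A. \<exists>B :: 'b cirl.
    commutative_involutive_residuated_lattice B \<and>
    (\<forall>n\<in>N. \<forall>x\<in>carrier B. x \<lesssim>\<^bsub>B\<^esub> x [^]\<^bsub>B\<^esub> n) \<and>
    l_bimonoidal_subreduct A B}"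

definition l_bimonoid_variety :: "nat set \<Rightarrow> 'a l_bimonoid set"
  where "l_bimonoid_variety N = {A. commutative_l_bimonoid A \<and>
    (\<forall>n\<in>N. \<forall>x\<in>carrier A. x \<preceq>\<^bsub>A\<^esub> x [^]\<^bsub>A\<^esub> n \<and> [n] \<cdot>\<^bsub>A\<^esub> x \<preceq>\<^bsub>A\<^esub> x)}"

end

theory Submission
  imports Defs "HOL-Algebra.Coset"
begin

text \<open>
  The inequality \<open>n x \<le> x\<close> holds in every subreduct because it is the De Morgan dual of
  \<open>x \<le> x ^ n\<close>. Conversely, a commutative l-bimonoid \<open>A\<close> is embedded into the algebra of closed sets
  of the phase space on the monoid \<open>(A, \<cdot>, 1) \<times> (A, +, 0)\<close> with pole \<open>{(a, b). a \<le> b}\<close>, where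
  \<open>(a, b)\<close> plays the role of \<open>a\<close> times the negation of \<open>b\<close>. Hemidistributivity says exactly that the
  closure of \<open>{(a, 0)}\<close> is the orthogonal of \<open>{(1, a)}\<close>, and \<open>a\<close> is mapped to this set. A product of
  closed sets can be computed on generators of the first kind, a sum on those of the second kind.
  Finally, if \<open>a \<le> a ^ n\<close> and \<open>n b \<le> b\<close> in \<open>A\<close>, then every point \<open>(a, b)\<close> lies in the closure of its
  \<open>n\<close>-th power, whence every closed set \<open>X\<close> satisfies \<open>X \<subseteq> X ^ n\<close>.
\<close>

section \<open>Phase spaces\<close>

locale phase_space = comm_monoid P for P :: "('c, 'm) monoid_scheme" (structure) +
  fixes D :: "'c set"
  assumes pole_subset: "D \<subseteq> carrier P"
begin

text \<open>Two points are orthogonal if their product lies in \<open>D\<close>. Commutativity makes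
  this relation symmetric, so \<open>perp\<close> forms a Galois connection with itself and
  \<open>cl\<close> is a closure operator.\<close>

definition perp :: "'c set \<Rightarrow> 'c set"
  where "perp X = {p \<in> carrier P. \<forall>q\<in>X. p \<otimes> q \<in> D}"

abbreviation cl :: "'c set \<Rightarrow> 'c set"
  where "cl X \<equiv> perp (perp X)"

text \<open>For closed \<open>Y\<close> the implication consists of all \<open>p\<close> whose
  products with points of \<open>X\<close> lie in \<open>Y\<close>. Written as an orthogonal, it is
  visibly closed.\<close>

definition phase_algebra :: "'c set cirl"
  where "phase_algebra =
    \<lparr>carrier = {X. X \<subseteq> carrier P \<and> cl X = X}, mult = (\<lambda>X Y. cl (X <#> Y)), one = cl {\<one>},
     rl_join = (\<lambda>X Y. cl (X \<union> Y)), rl_meet = (\<inter>),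
     rl_imp = (\<lambda>X Y. perp (X <#> perp Y)), rl_zero = D\<rparr>"

section \<open>Orthogonals and closure\<close>

lemma perp_subset [simp]: "perp X \<subseteq> carrier P"
  by (auto simp: perp_def)

lemma perp_antimono: "X \<subseteq> Y \<Longrightarrow> perp Y \<subseteq> perp X"
  by (auto simp: perp_def)

lemma cl_extensive: "X \<subseteq> carrier P \<Longrightarrow> X \<subseteq> cl X"
  by (auto simp: perp_def subset_iff m_comm)

lemma perp_cl [simp]: "X \<subseteq> carrier P \<Longrightarrow> perp (cl X) = perp X"
  by (simp add: cl_extensive perp_antimono subset_antisym)

lemma cl_least: "\<lbrakk>X \<subseteq> Y; cl Y = Y\<rbrakk> \<Longrightarrow> cl X \<subseteq> Y"
  using perp_antimono by metis

lemma perp_Un: "perp (X \<union> Y) = perp X \<inter> perp Y"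
  by (auto simp: perp_def)

text \<open>The intersection is the orthogonal of \<open>X \<union> Y\<close>, hence closed.
  Associativity of the join in \<open>phase_algebra\<close> rests on this.\<close>

lemma cl_perp_Int:
  "\<lbrakk>X \<subseteq> carrier P; Y \<subseteq> carrier P\<rbrakk> \<Longrightarrow> cl (perp X \<inter> perp Y) = perp X \<inter> perp Y"
  using perp_cl[of "X \<union> Y"] by (simp add: perp_Un)

lemma perp_one [simp]: "perp {\<one>} = D"
  using pole_subset by (auto simp: perp_def)

text \<open>Associativity moves the factor from \<open>X\<close> to the other side, so
  \<open>Y\<close> matters only through \<open>perp Y\<close>. This is why products of closed sets
  may be computed on generating sets.\<close>

lemma mem_perp_mult_iff:
  assumes "X \<subseteq> carrier P" "Y \<subseteq> carrier P"
  shows "p \<in> perp (X <#> Y) \<longleftrightarrow> p \<in> carrier P \<and> (\<forall>x\<in>X. p \<otimes> x \<in> perp Y)"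
  using assms by (auto simp: perp_def set_mult_def subset_iff m_assoc)

lemma set_mult_commute:
  "\<lbrakk>X \<subseteq> carrier P; Y \<subseteq> carrier P\<rbrakk> \<Longrightarrow> X <#> Y = Y <#> X"
  unfolding set_mult_def using m_comm by blast

lemma set_mult_assoc':
  "\<lbrakk>X \<subseteq> carrier P; Y \<subseteq> carrier P; Z \<subseteq> carrier P\<rbrakk>
    \<Longrightarrow> (X <#> Y) <#> Z = X <#> (Y <#> Z)"
  unfolding set_mult_def by (force simp: subset_iff m_assoc)

lemma perp_mult_cl_right:
  "\<lbrakk>X \<subseteq> carrier P; Y \<subseteq> carrier P\<rbrakk> \<Longrightarrow> perp (X <#> cl Y) = perp (X <#> Y)"
  by (auto simp: mem_perp_mult_iff)

lemma perp_mult_cl_left: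
  "\<lbrakk>X \<subseteq> carrier P; Y \<subseteq> carrier P\<rbrakk> \<Longrightarrow> perp (cl X <#> Y) = perp (X <#> Y)"
  using perp_mult_cl_right[of Y X] set_mult_commute by simp

lemma perp_mult_cl:
  "\<lbrakk>X \<subseteq> carrier P; Y \<subseteq> carrier P\<rbrakk> \<Longrightarrow> perp (cl X <#> cl Y) = perp (X <#> Y)"
  by (simp add: perp_mult_cl_left perp_mult_cl_right)

lemma set_mult_one: "X \<subseteq> carrier P \<Longrightarrow> X <#> {\<one>} = X"
  by (auto simp: set_mult_def subset_iff)

lemma mem_imp_iff:
  assumes "X \<subseteq> carrier P" "cl Y = Y"
  shows "p \<in> perp (X <#> perp Y) \<longleftrightarrow> p \<in> carrier P \<and> (\<forall>x\<in>X. p \<otimes> x \<in> Y)"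
  using assms by (simp add: mem_perp_mult_iff)

lemma pole_closed: "cl D = D"
  using perp_cl[of "{\<one>}"] by simp

lemma neg_eq_perp: "X \<subseteq> carrier P \<Longrightarrow> perp (X <#> perp D) = perp X"
  using perp_mult_cl_right[of X "{\<one>}"] by (simp add: set_mult_one)

theorem phase_algebra_cirl: "commutative_involutive_residuated_lattice phase_algebra"
proof -
  let ?B = phase_algebra
  have "comm_monoid ?B"
  proof (unfold_locales, goal_cases)
    case (2 X Y Z)
    then show ?case
      by (simp add: phase_algebra_def perp_mult_cl_left perp_mult_cl_right set_mult_closed
          set_mult_assoc')
  next
    case (4 X)
    then have "cl (cl {\<one>} <#> X) = cl (X <#> {\<one>})"
      using perp_mult_cl_left[of "{\<one>}" X] set_mult_commute[of X "{\<one>}"]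
      by (simp add: phase_algebra_def)
    then show ?case using 4 by (simp add: phase_algebra_def set_mult_one)
  next
    case (5 X)
    then show ?case
      using perp_mult_cl_right[of X "{\<one>}"] by (simp add: phase_algebra_def set_mult_one)
  next
    case (6 X Y)
    then show ?case by (simp add: phase_algebra_def set_mult_commute)
  qed (simp_all add: phase_algebra_def set_mult_closed pole_subset)
  moreover have "lattice_algebra (carrier ?B) (rl_join ?B) (rl_meet ?B)"
  proof (unfold_locales, goal_cases)
    case (2 X Y)
    then have "cl (X \<inter> Y) \<subseteq> X \<inter> Y"
      by (simp add: phase_algebra_def cl_least)
    moreover have "X \<inter> Y \<subseteq> cl (X \<inter> Y)"
      using 2 by (intro cl_extensive) (auto simp: phase_algebra_def)
    ultimately show ?case using 2 by (auto simp: phase_algebra_def)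
  next
    case (7 X Y)
    then show ?case by (simp add: phase_algebra_def Un_absorb2)
  next
    case (8 X Y)
    then show ?case using cl_extensive[of "X \<union> Y"] by (auto simp: phase_algebra_def)
  qed (simp_all add: phase_algebra_def perp_Un cl_perp_Int Int_ac)
  moreover have "commutative_involutive_residuated_lattice_axioms ?B"
  proof (unfold_locales, goal_cases)
    case (3 X Y Z)
    then have c: "X \<subseteq> carrier P" "Y \<subseteq> carrier P" "Z \<subseteq> carrier P" "cl Z = Z"
      by (auto simp: phase_algebra_def)
    \<comment> \<open>Both sides of residuation say that every product of a point of
      \<open>X\<close> and a point of \<open>Y\<close> lies in \<open>Z\<close>. Closedness of
      \<open>Z\<close> absorbs the closure in the product.\<close>
    have "cl (X <#> Y) \<subseteq> Z \<longleftrightarrow> X <#> Y \<subseteq> Z"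
      using c(4) cl_least[of _ Z] cl_extensive[OF set_mult_closed[OF c(1,2)]] by auto
    also have "\<dots> \<longleftrightarrow> (\<forall>y\<in>Y. \<forall>x\<in>X. y \<otimes> x \<in> Z)"
      unfolding set_mult_commute[OF c(1,2)] by (auto simp: set_mult_def)
    also have "\<dots> \<longleftrightarrow> Y \<subseteq> perp (X <#> perp Z)"
      using c by (auto simp: mem_imp_iff)
    finally show ?case by (simp add: phase_algebra_def rl_le_def Int_absorb2 inf.absorb_iff1)
  next
    case (4 X)
    then show ?case by (simp add: phase_algebra_def neg_eq_perp)
  qed (auto simp: phase_algebra_def set_mult_closed pole_subset pole_closed)
  ultimately show ?thesis
    by (simp add: commutative_involutive_residuated_lattice_def)
qed

text \<open>By \<open>contract\<close>, \<open>p\<close> lies in the closure of its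
  \<open>n\<close>-th power: whatever is orthogonal to \<open>X ^ n\<close> is orthogonal to
  \<open>p ^ n\<close>, hence to \<open>p\<close>. So \<open>X\<close> lies in the closure of
  \<open>X ^ n\<close>, which is closed already.\<close>

lemma phase_algebra_le_pow:
  assumes X: "X \<in> carrier phase_algebra"
    and contract: "\<And>p q. \<lbrakk>p \<in> carrier P; q \<in> carrier P; p [^] n \<otimes> q \<in> D\<rbrakk> \<Longrightarrow> p \<otimes> q \<in> D"
  shows "X \<lesssim>\<^bsub>phase_algebra\<^esub> X [^]\<^bsub>phase_algebra\<^esub> (n::nat)"
proof -
  interpret B: commutative_involutive_residuated_lattice phase_algebra
    by (rule phase_algebra_cirl)
  have pow: "p [^] k \<in> X [^]\<^bsub>phase_algebra\<^esub> k" if "p \<in> X" for p and k :: nat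
  proof (induction k)
    case 0
    then show ?case using cl_extensive[of "{\<one>}"] by (simp add: phase_algebra_def)
  next
    case (Suc k)
    let ?Y = "X [^]\<^bsub>phase_algebra\<^esub> k"
    have "?Y \<subseteq> carrier P" "X \<subseteq> carrier P"
      using X B.nat_pow_closed[OF X, of k] by (auto simp: phase_algebra_def)
    then have "?Y <#> X \<subseteq> cl (?Y <#> X)"
      by (intro cl_extensive set_mult_closed)
    moreover have "p [^] k \<otimes> p \<in> ?Y <#> X"
      using Suc that by (auto simp: set_mult_def)
    ultimately show ?case by (auto simp: phase_algebra_def)
  qed
  have "X [^]\<^bsub>phase_algebra\<^esub> n \<in> carrier phase_algebra"
    using X by simp
  then have closed: "cl (X [^]\<^bsub>phase_algebra\<^esub> n) = X [^]\<^bsub>phase_algebra\<^esub> n"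
    by (simp add: phase_algebra_def)
  have "X \<subseteq> cl (X [^]\<^bsub>phase_algebra\<^esub> n)"
  proof
    fix p assume p: "p \<in> X"
    then have pc: "p \<in> carrier P" using X by (auto simp: phase_algebra_def)
    have "p \<otimes> q \<in> D" if "q \<in> perp (X [^]\<^bsub>phase_algebra\<^esub> n)" for q
    proof (rule contract)
      show "q \<in> carrier P" using that by (simp add: perp_def)
      then show "p [^] n \<otimes> q \<in> D"
        using that pow[OF p, of n] pc by (auto simp: perp_def m_comm)
    qed (rule pc)
    then show "p \<in> cl (X [^]\<^bsub>phase_algebra\<^esub> n)"
      using pc by (simp add: perp_def)
  qed
  then show ?thesis using closed by (auto simp: phase_algebra_def rl_le_def)
qed

end

section \<open>The embedding\<close>

context commutative_l_bimonoid
begin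

section \<open>Order and monotonicity in an l-bimonoid\<close>

lemma le_refl: "x \<in> carrier A \<Longrightarrow> x \<preceq> x"
  unfolding lb_le_def by (metis join_absorb meet_absorb meet_closed)

lemma le_antisym: "\<lbrakk>x \<preceq> y; y \<preceq> x; x \<in> carrier A; y \<in> carrier A\<rbrakk> \<Longrightarrow> x = y"
  unfolding lb_le_def by (metis meet_comm)

lemma le_trans:
  "\<lbrakk>x \<preceq> y; y \<preceq> z; x \<in> carrier A; y \<in> carrier A; z \<in> carrier A\<rbrakk> \<Longrightarrow> x \<preceq> z"
  unfolding lb_le_def by (metis meet_assoc)

lemma le_iff_join: "\<lbrakk>x \<in> carrier A; y \<in> carrier A\<rbrakk> \<Longrightarrow> x \<preceq> y \<longleftrightarrow> x \<^bold>\<or> y = y"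
  unfolding lb_le_def by (metis join_absorb meet_absorb join_comm meet_comm)

lemma le_meet_iff: "\<lbrakk>x \<in> carrier A; y \<in> carrier A; z \<in> carrier A\<rbrakk>
    \<Longrightarrow> x \<preceq> y \<^bold>\<and> z \<longleftrightarrow> x \<preceq> y \<and> x \<preceq> z"
  unfolding lb_le_def by (smt (verit) meet_assoc meet_comm meet_closed le_refl lb_le_def)

lemma join_le_iff: "\<lbrakk>x \<in> carrier A; y \<in> carrier A; z \<in> carrier A\<rbrakk>
    \<Longrightarrow> x \<^bold>\<or> y \<preceq> z \<longleftrightarrow> x \<preceq> z \<and> y \<preceq> z"
  by (smt (verit) join_assoc join_comm join_closed le_iff_join le_refl)

lemma mult_mono: "\<lbrakk>y \<preceq> z; x \<in> carrier A; y \<in> carrier A; z \<in> carrier A\<rbrakk> \<Longrightarrow> x \<otimes> y \<preceq> x \<otimes> z"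
  by (metis le_iff_join mult_join m_closed)

lemma add_mono: "\<lbrakk>y \<preceq> z; x \<in> carrier A; y \<in> carrier A; z \<in> carrier A\<rbrakk> \<Longrightarrow> x \<oplus> y \<preceq> x \<oplus> z"
  by (metis lb_le_def add_meet)

section \<open>The phase space of pairs\<close>

definition pairs :: "('a \<times> 'a) monoid"
  where "pairs = A \<times>\<times> add_monoid A"

definition pole :: "('a \<times> 'a) set"
  where "pole = {(a, b). a \<in> carrier A \<and> b \<in> carrier A \<and> a \<preceq> b}"

lemma mem_pole_iff: "(a, b) \<in> pole \<longleftrightarrow> a \<in> carrier A \<and> b \<in> carrier A \<and> a \<preceq> b"
  by (simp add: pole_def)

lemma pairs_simps [simp]:
  "carrier pairs = carrier A \<times> carrier A"
  "(a, b) \<otimes>\<^bsub>pairs\<^esub> (c, d) = (a \<otimes> c, b \<oplus> d)"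
  "\<one>\<^bsub>pairs\<^esub> = (\<one>, \<zero>)"
  by (simp_all add: pairs_def DirProd_def)

lemma pairs_pow: "(a, b) [^]\<^bsub>pairs\<^esub> (n::nat) = (a [^] n, [n] \<cdot> b)"
  by (induction n) (simp_all add: add_pow_def)

sublocale phase: phase_space pairs pole
  by unfold_locales (auto simp: m_ac a_ac pole_def)

lemma phase_perp_subset [simp]: "phase.perp X \<subseteq> carrier A \<times> carrier A"
  using phase.perp_subset by simp

text \<open>With \<open>(x, y)\<close> read as \<open>x\<close> times the negation of
  \<open>y\<close>, the condition \<open>x \<preceq> y \<oplus> a\<close> says that this product is
  below \<open>a\<close>. So the set plays the role of the principal down-set of
  \<open>a\<close>.\<close>

definition embed :: "'a \<Rightarrow> ('a \<times> 'a) set"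
  where "embed a = phase.perp {(\<one>, a)}"

lemma mem_embed_iff:
  "a \<in> carrier A \<Longrightarrow> (x, y) \<in> embed a \<longleftrightarrow> x \<in> carrier A \<and> y \<in> carrier A \<and> x \<preceq> y \<oplus> a"
  by (auto simp: embed_def phase.perp_def mem_pole_iff)

text \<open>In the same reading these are the pairs below the negation of \<open>a\<close>.\<close>

lemma mem_perp_unit_iff:
  "a \<in> carrier A \<Longrightarrow>
    (c, d) \<in> phase.perp {(a, \<zero>)} \<longleftrightarrow> c \<in> carrier A \<and> d \<in> carrier A \<and> a \<otimes> c \<preceq> d"
  by (auto simp: phase.perp_def mem_pole_iff m_comm)

text \<open>One inclusion holds because \<open>(\<one>, a)\<close> and \<open>(a, \<zero>)\<close>
  are orthogonal. The other is a cut on \<open>a\<close>: from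
  \<open>x \<preceq> y \<oplus> a\<close> and \<open>a \<otimes> c \<preceq> d\<close> follows
  \<open>x \<otimes> c \<preceq> y \<oplus> d\<close>, and hemidistributivity moves \<open>c\<close>
  past \<open>y\<close>.\<close>

lemma embed_eq_cl:
  assumes a: "a \<in> carrier A"
  shows "embed a = phase.cl {(a, \<zero>)}"
proof (intro subset_antisym)
  have "(\<one>, a) \<in> phase.perp {(a, \<zero>)}"
    using a by (simp add: mem_perp_unit_iff le_refl)
  then show "phase.cl {(a, \<zero>)} \<subseteq> embed a"
    unfolding embed_def by (intro phase.perp_antimono) simp
next
  have "x \<otimes> c \<preceq> y \<oplus> d"
    if c: "x \<in> carrier A" "y \<in> carrier A" "c \<in> carrier A" "d \<in> carrier A"
      and "x \<preceq> y \<oplus> a" "a \<otimes> c \<preceq> d" for x y c d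
  proof -
    have "c \<otimes> x \<preceq> c \<otimes> (a \<oplus> y)"
      using that a by (metis mult_mono a_comm a_closed)
    also have "c \<otimes> (a \<oplus> y) \<preceq> (c \<otimes> a) \<oplus> y"
      using a c by (simp add: hemidistributive)
    finally (le_trans) have "c \<otimes> x \<preceq> y \<oplus> a \<otimes> c"
      using a c by (simp add: a_comm m_comm)
    moreover have "y \<oplus> a \<otimes> c \<preceq> y \<oplus> d"
      using that a by (intro add_mono) auto
    ultimately show ?thesis
      using a c le_trans[of "c \<otimes> x"] by (simp add: m_comm)
  qed
  then show "embed a \<subseteq> phase.cl {(a, \<zero>)}"
    using a by (auto simp: mem_embed_iff mem_perp_unit_iff mem_pole_iff
        phase.perp_def[of "phase.perp _"])
qed

section \<open>Injectivity and preservation of the operations\<close>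

lemma perp_embed: "a \<in> carrier A \<Longrightarrow> phase.perp (embed a) = phase.perp {(a, \<zero>)}"
  by (simp add: embed_eq_cl)

lemma embed_closed: "a \<in> carrier A \<Longrightarrow> embed a \<in> carrier phase.phase_algebra"
  by (simp add: phase.phase_algebra_def embed_def)

text \<open>The point \<open>(a, \<zero>)\<close> tests the order: it lies in \<open>embed b\<close>
  exactly if \<open>a \<preceq> b\<close>.\<close>

lemma embed_inj: "inj_on embed (carrier A)"
proof (rule inj_onI)
  fix a b assume ab: "a \<in> carrier A" "b \<in> carrier A" and eq: "embed a = embed b"
  have "(a, \<zero>) \<in> embed a" "(b, \<zero>) \<in> embed b"
    using ab by (simp_all add: mem_embed_iff le_refl)
  then have "(a, \<zero>) \<in> embed b" "(b, \<zero>) \<in> embed a"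
    by (simp_all add: eq)
  then show "a = b" using ab by (auto simp: mem_embed_iff intro: le_antisym)
qed

lemma embed_meet:
  assumes "a \<in> carrier A" "b \<in> carrier A"
  shows "embed (a \<^bold>\<and> b) = embed a \<inter> embed b"
  using assms by (auto simp: mem_embed_iff meet_closed add_meet le_meet_iff)

lemma embed_join:
  assumes "a \<in> carrier A" "b \<in> carrier A"
  shows "embed (a \<^bold>\<or> b) = phase.cl (embed a \<union> embed b)"
proof -
  have "(a \<^bold>\<or> b) \<otimes> c = a \<otimes> c \<^bold>\<or> b \<otimes> c" if "c \<in> carrier A" for c
    using assms that mult_join[of c a b] by (simp add: m_comm join_closed)
  then have "phase.perp {(a \<^bold>\<or> b, \<zero>)} = phase.perp {(a, \<zero>)} \<inter> phase.perp {(b, \<zero>)}"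
    using assms by (auto simp: mem_perp_unit_iff join_closed join_le_iff)
  then show ?thesis
    using assms by (simp add: phase.perp_Un perp_embed embed_eq_cl[of "a \<^bold>\<or> b"] join_closed)
qed

text \<open>The generators \<open>(a, \<zero>)\<close> and \<open>(b, \<zero>)\<close> multiply to
  the generator of \<open>embed (a \<otimes> b)\<close>.\<close>

lemma embed_mult:
  assumes "a \<in> carrier A" "b \<in> carrier A"
  shows "embed (a \<otimes> b) = phase.cl (embed a <#>\<^bsub>pairs\<^esub> embed b)"
  using assms by (simp add: embed_eq_cl phase.perp_mult_cl) (simp add: set_mult_def)

text \<open>The orthogonals on the right are the closures of \<open>{(\<one>, a)}\<close> and
  \<open>{(\<one>, b)}\<close>, whose generators multiply to
  \<open>(\<one>, a \<oplus> b)\<close>.\<close>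

lemma embed_add:
  assumes "a \<in> carrier A" "b \<in> carrier A"
  shows "embed (a \<oplus> b) =
    phase.perp (phase.perp (embed a) <#>\<^bsub>pairs\<^esub> phase.perp (embed b))"
  using assms by (simp add: embed_def phase.perp_mult_cl) (simp add: set_mult_def)

lemma embed_one: "embed \<one> = phase.cl {(\<one>, \<zero>)}"
  by (simp add: embed_eq_cl)

lemma embed_zero: "embed \<zero> = pole"
  using phase.perp_one by (simp add: embed_def)

lemma rl_neg_phase:
  "X \<subseteq> carrier pairs \<Longrightarrow> rl_neg phase.phase_algebra X = phase.perp X"
  by (simp add: rl_neg_def phase.phase_algebra_def phase.neg_eq_perp)

lemma embed_hom:
  assumes "a \<in> carrier A" "b \<in> carrier A"
  defines "R \<equiv> l_bimonoid_reduct phase.phase_algebra"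
  shows "embed (a \<otimes> b) = embed a \<otimes>\<^bsub>R\<^esub> embed b"
    and "embed (a \<oplus> b) = embed a \<oplus>\<^bsub>R\<^esub> embed b"
    and "embed (a \<^bold>\<or> b) = embed a \<^bold>\<or>\<^bsub>R\<^esub> embed b"
    and "embed (a \<^bold>\<and> b) = embed a \<^bold>\<and>\<^bsub>R\<^esub> embed b"
proof -
  let ?B = phase.phase_algebra
  have neg: "rl_neg ?B (embed c) = phase.perp (embed c)" for c
    by (simp add: embed_def rl_neg_phase)
  \<comment> \<open>The product of the two negations carries a closure, which the outer negation
    absorbs.\<close>
  have "embed a \<oplus>\<^bsub>R\<^esub> embed b =
      rl_neg ?B (phase.cl (phase.perp (embed a) <#>\<^bsub>pairs\<^esub> phase.perp (embed b)))"
    by (simp add: R_def l_bimonoid_reduct_def neg) (simp add: phase.phase_algebra_def)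
  also have "\<dots> = embed (a \<oplus> b)"
    using assms(1,2) phase.set_mult_closed
    by (simp add: rl_neg_phase embed_add)
  finally show "embed (a \<oplus> b) = embed a \<oplus>\<^bsub>R\<^esub> embed b" ..
qed (use assms(1,2) in \<open>simp_all add: R_def l_bimonoid_reduct_def phase.phase_algebra_def
    embed_mult embed_join embed_meet\<close>)

lemma embed_units:
  "embed \<one> = \<one>\<^bsub>l_bimonoid_reduct phase.phase_algebra\<^esub>"
  "embed \<zero> = \<zero>\<^bsub>l_bimonoid_reduct phase.phase_algebra\<^esub>"
  by (simp_all add: l_bimonoid_reduct_def phase.phase_algebra_def embed_one embed_zero)

text \<open>A power of \<open>(a, b)\<close> is a power of \<open>a\<close> paired with a multiple
  of \<open>b\<close>. The two inequalities bound \<open>a \<otimes> c\<close> by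
  \<open>a [^] n \<otimes> c\<close> and \<open>[n] \<cdot> b \<oplus> d\<close> by
  \<open>b \<oplus> d\<close>, which is the contraction condition on the pole.\<close>

lemma phase_algebra_contraction:
  assumes incr: "\<And>x. x \<in> carrier A \<Longrightarrow> x \<preceq> x [^] (n::nat)"
    and decr: "\<And>x. x \<in> carrier A \<Longrightarrow> [n] \<cdot> x \<preceq> x"
    and X: "X \<in> carrier phase.phase_algebra"
  shows "X \<lesssim>\<^bsub>phase.phase_algebra\<^esub> X [^]\<^bsub>phase.phase_algebra\<^esub> n"
proof (rule phase.phase_algebra_le_pow[OF X])
  fix p q assume pq: "p \<in> carrier pairs" "q \<in> carrier pairs" "p [^]\<^bsub>pairs\<^esub> n \<otimes>\<^bsub>pairs\<^esub> q \<in> pole"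
  obtain a b c d where eq: "p = (a, b)" "q = (c, d)" by fastforce
  have c: "a \<in> carrier A" "b \<in> carrier A" "c \<in> carrier A" "d \<in> carrier A"
    and le: "a [^] n \<otimes> c \<preceq> [n] \<cdot> b \<oplus> d"
    using pq by (auto simp: eq pairs_pow mem_pole_iff)
  have "c \<otimes> a \<preceq> c \<otimes> a [^] n"
    using c by (intro mult_mono incr) auto
  then have 1: "a \<otimes> c \<preceq> a [^] n \<otimes> c"
    using c by (simp add: m_comm)
  have "d \<oplus> [n] \<cdot> b \<preceq> d \<oplus> b"
    using c by (intro add_mono decr) auto
  then have 2: "[n] \<cdot> b \<oplus> d \<preceq> b \<oplus> d"
    using c by (simp add: a_comm)
  have "a \<otimes> c \<preceq> [n] \<cdot> b \<oplus> d"
    using c by (intro le_trans[OF 1 le]) auto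
  then have "a \<otimes> c \<preceq> b \<oplus> d"
    by (rule le_trans[OF _ 2]) (use c in auto)
  then show "p \<otimes>\<^bsub>pairs\<^esub> q \<in> pole"
    using c by (simp add: eq mem_pole_iff)
qed

end

section \<open>The two classes coincide\<close>

lemma l_bimonoidal_subreductI:
  fixes A :: "'a l_bimonoid" and B :: "'b cirl"
  defines "R \<equiv> l_bimonoid_reduct B"
  assumes A: "commutative_l_bimonoid A"
    and h: "inj_on h (carrier A)" "\<And>x. x \<in> carrier A \<Longrightarrow> h x \<in> carrier B"
    and hom: "\<And>x y. \<lbrakk>x \<in> carrier A; y \<in> carrier A\<rbrakk> \<Longrightarrow> h (x \<otimes>\<^bsub>A\<^esub> y) = h x \<otimes>\<^bsub>R\<^esub> h y"
      "\<And>x y. \<lbrakk>x \<in> carrier A; y \<in> carrier A\<rbrakk> \<Longrightarrow> h (x \<oplus>\<^bsub>A\<^esub> y) = h x \<oplus>\<^bsub>R\<^esub> h y"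
      "\<And>x y. \<lbrakk>x \<in> carrier A; y \<in> carrier A\<rbrakk> \<Longrightarrow> h (x \<^bold>\<or>\<^bsub>A\<^esub> y) = h x \<^bold>\<or>\<^bsub>R\<^esub> h y"
      "\<And>x y. \<lbrakk>x \<in> carrier A; y \<in> carrier A\<rbrakk> \<Longrightarrow> h (x \<^bold>\<and>\<^bsub>A\<^esub> y) = h x \<^bold>\<and>\<^bsub>R\<^esub> h y"
      "h \<one>\<^bsub>A\<^esub> = \<one>\<^bsub>R\<^esub>" "h \<zero>\<^bsub>A\<^esub> = \<zero>\<^bsub>R\<^esub>"
  shows "l_bimonoidal_subreduct A B"
proof -
  interpret commutative_l_bimonoid A by fact
  have "lb_subalgebra (h ` carrier A) R"
    unfolding lb_subalgebra_def
  proof (intro conjI ballI)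
    show "h ` carrier A \<subseteq> carrier R"
      using h(2) by (auto simp: R_def l_bimonoid_reduct_def)
    show "\<one>\<^bsub>R\<^esub> \<in> h ` carrier A" "\<zero>\<^bsub>R\<^esub> \<in> h ` carrier A"
      by (auto simp flip: hom)
  qed (auto simp: join_closed meet_closed simp flip: hom)
  moreover have "h \<in> lb_iso A (R\<lparr>carrier := h ` carrier A\<rparr>)"
    using h(1) by (simp add: lb_iso_def hom inj_on_imp_bij_betw)
  ultimately show ?thesis
    using A unfolding l_bimonoidal_subreduct_def R_def by blast
qed

lemma variety_subset_subreducts:
  "(l_bimonoid_variety N :: 'a l_bimonoid set) \<subseteq> l_bimonoidal_subreducts TYPE(('a \<times> 'a) set) N"
proof
  fix A :: "'a l_bimonoid" assume A: "A \<in> l_bimonoid_variety N"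
  then interpret commutative_l_bimonoid A by (simp add: l_bimonoid_variety_def)
  have "l_bimonoidal_subreduct A phase.phase_algebra"
    by (rule l_bimonoidal_subreductI[OF commutative_l_bimonoid_axioms embed_inj embed_closed
          embed_hom embed_units])
  moreover have "\<forall>n\<in>N. \<forall>X\<in>carrier phase.phase_algebra.
      X \<lesssim>\<^bsub>phase.phase_algebra\<^esub> X [^]\<^bsub>phase.phase_algebra\<^esub> n"
    using A by (intro ballI phase_algebra_contraction) (auto simp: l_bimonoid_variety_def)
  ultimately show "A \<in> l_bimonoidal_subreducts TYPE(('a \<times> 'a) set) N"
    using phase.phase_algebra_cirl by (auto simp: l_bimonoidal_subreducts_def)
qed

lemma subreducts_subset_variety:
  "(l_bimonoidal_subreducts TYPE('b) N :: 'a l_bimonoid set) \<subseteq> l_bimonoid_variety N"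
proof
  fix A :: "'a l_bimonoid" assume "A \<in> l_bimonoidal_subreducts TYPE('b) N"
  then obtain B :: "'b cirl"
    where B: "commutative_involutive_residuated_lattice B"
      and contract: "\<And>n x. \<lbrakk>n \<in> N; x \<in> carrier B\<rbrakk> \<Longrightarrow> x \<lesssim>\<^bsub>B\<^esub> x [^]\<^bsub>B\<^esub> n"
      and sub: "l_bimonoidal_subreduct A B"
    by (auto simp: l_bimonoidal_subreducts_def)
  then obtain S h
    where A: "commutative_l_bimonoid A"
      and S: "lb_subalgebra S (l_bimonoid_reduct B)"
      and iso: "h \<in> lb_iso A ((l_bimonoid_reduct B)\<lparr>carrier := S\<rparr>)"
    unfolding l_bimonoidal_subreduct_def by blast
  interpret A: commutative_l_bimonoid A by fact
  interpret B: commutative_involutive_residuated_lattice B by fact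
  have inj: "inj_on h (carrier A)"
    using iso by (simp add: lb_iso_def bij_betw_def)
  have hB: "h x \<in> carrier B" if "x \<in> carrier A" for x
    using iso S that by (auto simp: lb_iso_def bij_betw_def lb_subalgebra_def l_bimonoid_reduct_def)
  have one: "h \<one>\<^bsub>A\<^esub> = \<one>\<^bsub>B\<^esub>" and zero: "h \<zero>\<^bsub>A\<^esub> = rl_zero B"
    using iso by (simp_all add: lb_iso_def l_bimonoid_reduct_def)
  have hom: "h (x \<otimes>\<^bsub>A\<^esub> y) = h x \<otimes>\<^bsub>B\<^esub> h y"
    "h (x \<oplus>\<^bsub>A\<^esub> y) = rl_neg B (rl_neg B (h x) \<otimes>\<^bsub>B\<^esub> rl_neg B (h y))"
    "h (x \<^bold>\<and>\<^bsub>A\<^esub> y) = rl_meet B (h x) (h y)"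
    if "x \<in> carrier A" "y \<in> carrier A" for x y
    using iso that by (simp_all add: lb_iso_def l_bimonoid_reduct_def)
  have pow: "h (x [^]\<^bsub>A\<^esub> k) = h x [^]\<^bsub>B\<^esub> k" if "x \<in> carrier A" for x and k :: nat
    using that by (induction k) (simp_all add: one hom)
  \<comment> \<open>Iterated sums are De Morgan duals of powers. For \<open>k = 0\<close> the empty
    sum \<open>rl_zero B\<close> is the negation of the empty product.\<close>
  have mult: "h ([k] \<cdot>\<^bsub>A\<^esub> x) = rl_neg B (rl_neg B (h x) [^]\<^bsub>B\<^esub> k)"
    if "x \<in> carrier A" for x and k :: nat
  proof (induction k)
    case 0
    then show ?case
      using B.neg_neg[OF B.rl_zero_closed] by (simp add: zero B.neg_zero)
  next
    case (Suc k)
    then show ?case using that by (simp add: hom hB)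
  qed
  \<comment> \<open>The order is the equation saying that the meet is \<open>x\<close>, so an
    injective map preserving meets reflects it.\<close>
  have reflect: "x \<preceq>\<^bsub>A\<^esub> y" if "h x \<lesssim>\<^bsub>B\<^esub> h y" "x \<in> carrier A" "y \<in> carrier A" for x y
    using that inj by (auto simp: lb_le_def rl_le_def A.meet_closed simp flip: hom dest: inj_onD)
  have "x \<preceq>\<^bsub>A\<^esub> x [^]\<^bsub>A\<^esub> n \<and> [n] \<cdot>\<^bsub>A\<^esub> x \<preceq>\<^bsub>A\<^esub> x" if n: "n \<in> N" and x: "x \<in> carrier A" for n x
  proof
    show "x \<preceq>\<^bsub>A\<^esub> x [^]\<^bsub>A\<^esub> n"
      using n x by (intro reflect) (simp_all add: pow contract hB)
    \<comment> \<open>This is \<open>contract\<close> at the negation of \<open>h x\<close>, turned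
      around by the order-reversing negation.\<close>
    have "rl_neg B (rl_neg B (h x) [^]\<^bsub>B\<^esub> n) \<lesssim>\<^bsub>B\<^esub> rl_neg B (rl_neg B (h x))"
      using n x by (simp add: B.neg_le_neg contract hB del: B.neg_neg)
    then show "[n] \<cdot>\<^bsub>A\<^esub> x \<preceq>\<^bsub>A\<^esub> x"
      using x by (intro reflect) (simp_all add: mult hB)
  qed
  then show "A \<in> l_bimonoid_variety N"
    using A by (simp add: l_bimonoid_variety_def)
qed

text \<open>The phase algebra over pairs has elements of type \<open>('a \<times> 'a) set\<close>,
  so this type suffices to represent every member of the variety. The first conjunct shows that no
  other type \<open>'b\<close> yields further algebras.\<close>

theorem mainTheorem18:
  fixes N :: "nat set"
  assumes "\<forall>n\<in>N. 0 < n"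
  shows "(l_bimonoidal_subreducts TYPE('b) N :: 'a l_bimonoid set) \<subseteq> l_bimonoid_variety N \<and>
    (l_bimonoidal_subreducts TYPE(('a \<times> 'a) set) N :: 'a l_bimonoid set) = l_bimonoid_variety N"
  by (intro conjI subset_antisym subreducts_subset_variety variety_subset_subreducts)

end
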